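(* Let $\epsilon\in(0,1)$ and let $S\subseteq\mathbb{N}$ be any finite nonempty set. Then $$z_S^{(0,1-\epsilon)}\leq \frac{1}{2\pi}\left(\log\left(\frac{2}{\epsilon}\right)+\frac{4}{\sqrt{\epsilon}}-4\right),$$ where $\log$ is the natural logarithm.
   Context: $\mathbb{N}=\{0,1,2,\dots\}$. For a finite nonempty set $S=\{e_1,\dots,e_k\}\subseteq\mathbb{N}$ (distinct elements), let $f_S(x)=\sum_{i=1}^k a_i x^{e_i}$, where $a_1,\dots,a_k$ are independent standard normal random variables. For an open interval $I\subseteq(0,\infty)$, $z_S^I$ denotes the expected number of zeros of $f_S$ in $I$. *)

theory Defs
  imports "HOL-Probability.Probability"
begin

definition coeff_space :: "nat set \<Rightarrow> (nat \<Rightarrow> real) measure" where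
  "coeff_space S = PiM S (\<lambda>_. density lborel std_normal_density)"

definition rand_poly :: "nat set \<Rightarrow> (nat \<Rightarrow> real) \<Rightarrow> real \<Rightarrow> real" where
  "rand_poly S a x = (\<Sum>e\<in>S. a e * x ^ e)"

text \<open>Number of (distinct) zeros of f_S in I (the identically-zero case has probability 0).\<close>
definition num_zeros :: "nat set \<Rightarrow> real set \<Rightarrow> (nat \<Rightarrow> real) \<Rightarrow> nat" where
  "num_zeros S I a = card {x \<in> I. rand_poly S a x = 0}"

definition expected_zeros :: "nat set \<Rightarrow> real set \<Rightarrow> ennreal" where
  "expected_zeros S I = (\<integral>\<^sup>+ a. ennreal (real (num_zeros S I a)) \<partial>coeff_space S)"

end

theory Submission
  imports Defs
begin

text \<open>
  Dividing by the lowest power of \<open>x\<close> one may write \<open>f = a\<^sub>m + G\<close>, where the random function \<open>G\<close> is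
  independent of \<open>a\<^sub>m\<close>. Cut \<open>(0, b)\<close> into \<open>n\<close> cells. If \<open>f\<close> vanishes in the cell \<open>[p, q]\<close> then
  \<open>\<bar>f p + f q\<bar> \<le> L\<close>, where \<open>L\<close> is the integral of \<open>\<bar>G'\<bar>\<close> over the cell; this confines \<open>a\<^sub>m\<close> to an
  interval of length \<open>L\<close>, which given \<open>G\<close> has probability at most \<open>L / sqrt (2 \<pi>)\<close>. Summing over
  the cells and letting \<open>n\<close> tend to infinity (Fatou), the expected number of zeros is at most the
  integral of \<open>E \<bar>G' t\<bar> / sqrt (2 \<pi>)\<close> over \<open>(0, b)\<close>. Finally \<open>E \<bar>G' t\<bar>\<close> is at most the square root of
  the sum of \<open>n\<^sup>2 t\<^bsup>2 n - 2\<^esup>\<close> over all \<open>n\<close>, which equals \<open>(1 + t\<^sup>2) / (1 - t\<^sup>2)\<^sup>3\<close>.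
\<close>

abbreviation std_normal :: "real measure" where
  "std_normal \<equiv> density lborel std_normal_density"

section \<open>Zeros and cells of a uniform grid\<close>

text \<open>Once the mesh \<open>b / n\<close> is smaller than the least gap between points of
  \<open>Z\<close>, no cell holds two of them, so sending a point to its cell is injective.\<close>

lemma eventually_card_le_card_cells:
  fixes Z :: "real set" and b :: real
  assumes "finite Z" and Z: "Z \<subseteq> {0<..<b}"
  shows "\<forall>\<^sub>F n in sequentially.
    card Z \<le> card {i. i < n \<and> (\<exists>x\<in>Z. real i * b / real n \<le> x \<and> x \<le> real (Suc i) * b / real n)}"
proof -
  define D where "D = (\<lambda>(x, y). \<bar>x - y\<bar>) ` {(x, y) \<in> Z \<times> Z. x \<noteq> y}"
  have "finite D"
    unfolding D_def
    by (rule finite_imageI, rule finite_subset[of _ "Z \<times> Z"]) (use \<open>finite Z\<close> in auto)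
  moreover have "\<forall>d\<in>D. 0 < d" by (auto simp: D_def)
  \<comment> \<open>Inserting 1 keeps the minimum defined when \<open>Z\<close> has fewer than two
    points and \<open>D\<close> is empty.\<close>
  ultimately have "0 < Min (insert 1 D)" "\<forall>d\<in>D. Min (insert 1 D) \<le> d"
    by simp_all
  then obtain \<delta> where "\<delta> > 0" and \<delta>: "\<And>x y. x \<in> Z \<Longrightarrow> y \<in> Z \<Longrightarrow> x \<noteq> y \<Longrightarrow> \<delta> \<le> \<bar>x - y\<bar>"
    unfolding D_def by fast
  have "(\<lambda>n. b / real n) \<longlonglongrightarrow> 0" by (rule lim_const_over_n)
  then have "\<forall>\<^sub>F n in sequentially. b / real n < \<delta>"
    using \<open>\<delta> > 0\<close> by (rule order_tendstoD)
  with eventually_gt_at_top[of 0] show ?thesis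
  proof eventually_elim
    case (elim n)
    define c where "c x = nat \<lfloor>x * real n / b\<rfloor>" for x
    have c: "real (c x) * b / real n \<le> x" "x < real (Suc (c x)) * b / real n" "c x < n" if "x \<in> Z" for x
    proof -
      have x: "0 < x" "x < b" using Z that by auto
      have c1: "real (c x) \<le> x * real n / b" "x * real n / b < real (c x) + 1"
        unfolding c_def using x \<open>0 < n\<close> by (simp_all add: of_nat_nat)
      show "real (c x) * b / real n \<le> x" "x < real (Suc (c x)) * b / real n"
        using c1 x \<open>0 < n\<close> by (simp_all add: field_simps)
      have "x * real n / b < real n" using x \<open>0 < n\<close> by (simp add: field_simps)
      with c1(1) have "real (c x) < real n" by linarith
      then show "c x < n" by simp
    qed
    have "inj_on c Z"
    proof (rule inj_onI, rule ccontr)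
      fix x y assume xy: "x \<in> Z" "y \<in> Z" "c x = c y" "x \<noteq> y"
      have "real (Suc (c y)) * b / real n = real (c y) * b / real n + b / real n"
        by (simp add: algebra_simps add_divide_distrib)
      then have "\<bar>x - y\<bar> < b / real n"
        using c(1,2)[OF xy(1)] c(1,2)[OF xy(2)] xy(3) by (simp only: abs_less_iff) linarith
      with \<delta>[OF xy(1,2,4)] elim show False by linarith
    qed
    moreover have "c ` Z \<subseteq> {i. i < n \<and> (\<exists>x\<in>Z. real i * b / real n \<le> x \<and> x \<le> real (Suc i) * b / real n)}"
      using c less_imp_le[OF c(2)] by blast
    ultimately show ?case
      by (rule card_inj_on_le) simp
  qed
qed

text \<open>Up to sign, both endpoint values are integrals of \<open>f'\<close> between the zero
  \<open>y\<close> and an endpoint, over adjacent pieces of the cell, so even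
  \<open>\<bar>f p\<bar> + \<bar>f q\<bar>\<close> obeys the bound. The sum is used because it
  contains the constant coefficient twice: this confines the coefficient to an interval half as long
  as the same bound on one endpoint value would.\<close>

lemma abs_endpoint_sum_le_variation:
  fixes f f' :: "real \<Rightarrow> real"
  assumes deriv: "\<And>x. (f has_real_derivative f' x) (at x)" and cont: "continuous_on UNIV f'"
    and y: "p \<le> y" "y \<le> q" "f y = 0"
  shows "ennreal \<bar>f p + f q\<bar> \<le> (\<integral>\<^sup>+t. ennreal \<bar>f' t\<bar> * indicator {p<..<q} t \<partial>lborel)"
proof -
  have int: "(\<lambda>t. \<bar>f' t\<bar>) integrable_on {u..v}" "f' integrable_on {u..v}" for u v
    by (intro integrable_continuous_real continuous_intros continuous_on_subset[OF cont]; simp)+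
  have ftc: "\<bar>f v - f u\<bar> \<le> integral {u..v} (\<lambda>t. \<bar>f' t\<bar>)" if "u \<le> v" for u v
  proof -
    have "(f' has_integral (f v - f u)) {u..v}"
      using deriv that
      by (intro fundamental_theorem_of_calculus)
         (auto simp: has_real_derivative_iff_has_vector_derivative[symmetric] intro: has_field_derivative_at_within)
    then have "f v - f u = integral {u..v} f'" by (simp add: integral_unique)
    then show ?thesis
      using integral_norm_bound_integral[OF int(2) int(1), of u v] by simp
  qed
  have "\<bar>f p + f q\<bar> \<le> integral {p..y} (\<lambda>t. \<bar>f' t\<bar>) + integral {y..q} (\<lambda>t. \<bar>f' t\<bar>)"
    using ftc[OF y(1)] ftc[OF y(2)] y(3) by linarith
  also have "\<dots> = integral {p..q} (\<lambda>t. \<bar>f' t\<bar>)"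
    using y int(1) by (intro Henstock_Kurzweil_Integration.integral_combine) auto
  finally have le: "\<bar>f p + f q\<bar> \<le> integral {p..q} (\<lambda>t. \<bar>f' t\<bar>)" .
  have "((\<lambda>t. \<bar>f' t\<bar>) has_integral integral {p..q} (\<lambda>t. \<bar>f' t\<bar>)) {p<..<q}"
    using int(1) by (simp add: has_integral_Icc_iff_Ioo[symmetric] integrable_integral)
  then have "(\<integral>\<^sup>+t. ennreal (indicator {p<..<q} t * \<bar>f' t\<bar>) \<partial>lborel) = integral {p..q} (\<lambda>t. \<bar>f' t\<bar>)"
    by (intro nn_integral_has_integral_lebesgue) auto
  with le show ?thesis
    by (simp add: ennreal_mult'' ennreal_indicator mult.commute ennreal_leI)
qed

section \<open>Estimates for Gaussian variables and linear forms\<close>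

lemma emeasure_std_normal_le:
  assumes [measurable]: "A \<in> sets borel"
  shows "emeasure std_normal A \<le> ennreal (1 / sqrt (2 * pi)) * emeasure lborel A"
proof -
  have "emeasure std_normal A = (\<integral>\<^sup>+x. ennreal (std_normal_density x) * indicator A x \<partial>lborel)"
    by (rule emeasure_density) auto
  also have "\<dots> \<le> (\<integral>\<^sup>+x. ennreal (1 / sqrt (2 * pi)) * indicator A x \<partial>lborel)"
    by (intro nn_integral_mono mult_right_mono ennreal_leI)
       (auto simp: std_normal_density_def field_simps)
  also have "\<dots> = ennreal (1 / sqrt (2 * pi)) * emeasure lborel A"
    by (simp add: nn_integral_cmult)
  finally show ?thesis .
qed

text \<open>For finite \<open>L\<close> the strip is an interval of length \<open>L\<close>, the
  factor 2 halving the width \<open>2 * L\<close>, and the normal density is at most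
  \<open>1 / sqrt (2 * pi)\<close>. For infinite \<open>L\<close> the right side is
  infinite.\<close>

lemma emeasure_std_normal_strip_le:
  "emeasure std_normal {y. ennreal \<bar>2 * y + c\<bar> \<le> L} \<le> ennreal (1 / sqrt (2 * pi)) * L"
proof (cases L)
  case (real l)
  have eq: "{y. ennreal \<bar>2 * y + c\<bar> \<le> L} = {(- c - l) / 2..(l - c) / 2}"
    using real by (auto simp: abs_le_iff field_simps)
  then show ?thesis
    using emeasure_std_normal_le[of "{(- c - l) / 2..(l - c) / 2}"] real by (simp add: field_simps)
next
  case top
  then show ?thesis by (simp add: ennreal_mult_top)
qed

lemma nn_integral_std_normal_affine_square:
  "(\<integral>\<^sup>+y. ennreal ((c * y + s)\<^sup>2) \<partial>std_normal) = ennreal (c\<^sup>2 + s\<^sup>2)"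
proof -
  have 1: "has_bochner_integral lborel (\<lambda>x. std_normal_density x * x ^ 2) 1"
    using std_normal_moment_even[of 1] by (simp add: fact_numeral)
  have 2: "has_bochner_integral lborel (\<lambda>x. std_normal_density x * x ^ 1) 0"
    using std_normal_moment_odd[of 0] by simp
  have 3: "has_bochner_integral lborel (\<lambda>x. std_normal_density x) 1"
    using std_normal_moment_even[of 0] by simp
  have "has_bochner_integral lborel
     (\<lambda>x. (std_normal_density x * x ^ 2) * c\<^sup>2 + ((std_normal_density x * x ^ 1) * (2 * c * s) + std_normal_density x * s\<^sup>2))
     (1 * c\<^sup>2 + (0 * (2 * c * s) + 1 * s\<^sup>2))"
    by (intro has_bochner_integral_add has_bochner_integral_mult_left 1 2 3)
  then have "has_bochner_integral lborel (\<lambda>x. std_normal_density x * (c * x + s)\<^sup>2) (c\<^sup>2 + s\<^sup>2)"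
    by (simp add: algebra_simps power2_eq_square)
  then have "(\<integral>\<^sup>+x. ennreal (std_normal_density x * (c * x + s)\<^sup>2) \<partial>lborel) = ennreal (c\<^sup>2 + s\<^sup>2)"
    by (simp add: has_bochner_integral_iff nn_integral_eq_integral)
  then show ?thesis
    by (simp add: nn_integral_density ennreal_mult')
qed

interpretation std_normal: prob_space std_normal
  by (rule prob_space_normal_density) simp

interpretation std_normal_prod: product_prob_space "\<lambda>_. std_normal" UNIV
  by unfold_locales

text \<open>Cross terms vanish because the coordinates are independent and centred. The induction
  integrates out one coordinate at a time, the others being frozen in the shift \<open>s\<close> of
  the affine formula.\<close>

lemma nn_integral_linear_form_square:
  assumes "finite T"
  shows "(\<integral>\<^sup>+a. ennreal ((\<Sum>e\<in>T. a e * c e)\<^sup>2) \<partial>PiM T (\<lambda>_. std_normal)) = ennreal (\<Sum>e\<in>T. (c e)\<^sup>2)"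
  using assms
proof (induction T)
  case empty
  then show ?case by simp
next
  case (insert i T)
  have "(\<integral>\<^sup>+a. ennreal ((\<Sum>e\<in>insert i T. a e * c e)\<^sup>2) \<partial>PiM (insert i T) (\<lambda>_. std_normal))
     = (\<integral>\<^sup>+a. (\<integral>\<^sup>+y. ennreal ((\<Sum>e\<in>insert i T. (a(i := y)) e * c e)\<^sup>2) \<partial>std_normal) \<partial>PiM T (\<lambda>_. std_normal))"
    using insert by (intro std_normal_prod.product_nn_integral_insert) measurable
  also have "\<dots> = (\<integral>\<^sup>+a. (\<integral>\<^sup>+y. ennreal ((c i * y + (\<Sum>e\<in>T. a e * c e))\<^sup>2) \<partial>std_normal) \<partial>PiM T (\<lambda>_. std_normal))"
  proof -
    have "(\<Sum>e\<in>T. (a(i := y)) e * c e) = (\<Sum>e\<in>T. a e * c e)" for a :: "'a \<Rightarrow> real" and y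
      using insert by (intro sum.cong) auto
    then show ?thesis using insert by (simp add: mult.commute)
  qed
  also have "\<dots> = (\<integral>\<^sup>+a. ennreal ((c i)\<^sup>2) + ennreal ((\<Sum>e\<in>T. a e * c e)\<^sup>2) \<partial>PiM T (\<lambda>_. std_normal))"
    by (simp add: nn_integral_std_normal_affine_square)
  also have "\<dots> = ennreal ((c i)\<^sup>2) + ennreal (\<Sum>e\<in>T. (c e)\<^sup>2)"
    using insert.IH prob_space.emeasure_space_1[OF prob_space_PiM[OF std_normal.prob_space_axioms], of T]
    by (subst nn_integral_add) auto
  finally show ?case using insert by (simp add: sum_nonneg)
qed

text \<open>The second moment controls the first, as in Cauchy-Schwarz. Here this comes from the
  pointwise inequality \<open>am\<close> between arithmetic and geometric means, with
  \<open>s\<close> the standard deviation, so that both halves contribute \<open>s / 2\<close>. The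
  zero form is split off because \<open>s\<close> is a divisor.\<close>

lemma nn_integral_abs_linear_form_le:
  assumes "finite T"
  shows "(\<integral>\<^sup>+a. ennreal \<bar>\<Sum>e\<in>T. a e * c e\<bar> \<partial>PiM T (\<lambda>_. std_normal)) \<le> ennreal (sqrt (\<Sum>e\<in>T. (c e)\<^sup>2))"
proof (cases "\<forall>e\<in>T. c e = 0")
  case True
  then show ?thesis by simp
next
  case False
  define s where "s = sqrt (\<Sum>e\<in>T. (c e)\<^sup>2)"
  have "(\<Sum>e\<in>T. (c e)\<^sup>2) \<noteq> 0" using False assms by (simp add: sum_nonneg_eq_0_iff)
  then have s: "s > 0" "(\<Sum>e\<in>T. (c e)\<^sup>2) = s\<^sup>2"
    by (auto simp: s_def sum_nonneg order.strict_iff_order)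
  have am: "\<bar>x\<bar> \<le> x\<^sup>2 / (2 * s) + s / 2" for x
  proof -
    have "0 \<le> (\<bar>x\<bar> - s)\<^sup>2" by simp
    then show ?thesis using s(1) by (simp add: power2_diff field_simps power2_eq_square)
  qed
  have "(\<integral>\<^sup>+a. ennreal \<bar>\<Sum>e\<in>T. a e * c e\<bar> \<partial>PiM T (\<lambda>_. std_normal))
    \<le> (\<integral>\<^sup>+a. ennreal (1 / (2 * s)) * ennreal ((\<Sum>e\<in>T. a e * c e)\<^sup>2) + ennreal (s / 2) \<partial>PiM T (\<lambda>_. std_normal))"
    using s(1) am by (intro nn_integral_mono)
      (simp add: ennreal_mult'[symmetric] ennreal_plus[symmetric] del: ennreal_plus)
  also have "\<dots> = ennreal (1 / (2 * s)) * ennreal (s\<^sup>2) + ennreal (s / 2)"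
    using nn_integral_linear_form_square[OF assms, of c] s(2)
      prob_space.emeasure_space_1[OF prob_space_PiM[OF std_normal.prob_space_axioms], of T]
    by (subst nn_integral_add; simp add: nn_integral_cmult)
  also have "\<dots> = ennreal s"
    using s(1) by (simp add: ennreal_mult'[symmetric] ennreal_plus[symmetric] power2_eq_square del: ennreal_plus)
  finally show ?thesis by (simp add: s_def)
qed

section \<open>A power series with square coefficients and its majorant\<close>

text \<open>Finite form, with explicit remainder, of the series with sum
  \<open>(1 + u) / (1 - u) ^ 3\<close>. For \<open>0 \<le> u\<close> the subtracted remainder is
  nonnegative, so dropping it leaves an upper bound.\<close>

lemma sum_square_power_identity:
  fixes u :: real
  shows "(1 - u) ^ 3 * (\<Sum>n<N. (real n + 1)\<^sup>2 * u ^ n) = 1 + u - u ^ N * ((real N * (1 - u) + 1)\<^sup>2 + u)"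
proof (induction N)
  case (Suc N)
  then show ?case
    by (simp add: distrib_left) (simp add: algebra_simps power2_eq_square power3_eq_cube)
qed simp


lemma sum_square_power_le:
  fixes u :: real
  assumes "finite A" "0 \<le> u" "u < 1"
  shows "(\<Sum>n\<in>A. (real n)\<^sup>2 * u ^ (n - 1)) \<le> (1 + u) / (1 - u) ^ 3"
proof -
  obtain N where N: "A \<subseteq> {..<Suc N}"
    using finite_nat_bounded[OF \<open>finite A\<close>] by (metis lessThan_Suc subset_insertI2)
  have "(\<Sum>n\<in>A. (real n)\<^sup>2 * u ^ (n - 1)) \<le> (\<Sum>n<Suc N. (real n)\<^sup>2 * u ^ (n - 1))"
    using assms N by (intro sum_mono2) auto
  \<comment> \<open>The term \<open>n = 0\<close>, whose exponent is truncated, carries the factor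
    0.\<close>
  also have "\<dots> = (\<Sum>n<N. (real n + 1)\<^sup>2 * u ^ n)"
    by (subst sum.lessThan_Suc_shift) (simp add: add.commute)
  finally have "(1 - u) ^ 3 * (\<Sum>n\<in>A. (real n)\<^sup>2 * u ^ (n - 1)) \<le> (1 - u) ^ 3 * (\<Sum>n<N. (real n + 1)\<^sup>2 * u ^ n)"
    using assms by (intro mult_left_mono) auto
  also have "\<dots> \<le> 1 + u"
    unfolding sum_square_power_identity using assms by simp
  finally show ?thesis
    using assms by (simp add: field_simps)
qed

text \<open>Since \<open>1 - t^2 = (1 - t) * (1 + t)\<close>, this is what remains, after cancelling
  \<open>(1 - t) ^ 3\<close>, of comparing the sum of the series at \<open>u = t^2\<close> with
  \<open>2 / pi\<close> times the square of the majorant integrated at the end.\<close>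

lemma density_ratio_le:
  fixes x :: real
  assumes x: "0 \<le> x" "x < 1"
  shows "(1 + x\<^sup>2) / (1 + x) ^ 3 \<le> 2 / pi * (1 + sqrt (1 - x) / 2)\<^sup>2"
proof -
  \<comment> \<open>A rational number just below \<open>2 / pi\<close> removes \<open>pi\<close>
    from the remaining estimates.\<close>
  have pi: "5 / 8 \<le> 2 / pi"
    using pi_less_4 pi_approx by (simp add: field_simps)
  have "(1 + x\<^sup>2) / (1 + x) ^ 3 \<le> 5 / 8 * (1 + sqrt (1 - x) / 2)\<^sup>2"
  \<comment> \<open>The threshold is where \<open>5 / 8 * (1 + 3 * x)\<close> reaches 1. Above it
    the constant \<open>5 / 8\<close> alone suffices; below it the left side is at most 1 and the
    square root supplies the missing factor.\<close>
  proof (cases "x \<le> 1 / 5")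
    case True
    have "4 / 5 \<le> sqrt (1 - x)"
      using True by (intro real_le_rsqrt) (simp add: power2_eq_square)
    then have "(7 / 5)\<^sup>2 \<le> (1 + sqrt (1 - x) / 2)\<^sup>2"
      by (intro power_mono) auto
    moreover have "1 + x\<^sup>2 \<le> (1 + x) ^ 3"
      using x by (simp add: power2_eq_square power3_eq_cube algebra_simps)
    then have "(1 + x\<^sup>2) / (1 + x) ^ 3 \<le> 1"
      using x by simp
    moreover have "(1::real) \<le> 5 / 8 * (7 / 5)\<^sup>2" by (simp add: power2_eq_square)
    ultimately show ?thesis by linarith
  next
    case False
    have "0 \<le> x ^ 3" "0 \<le> x\<^sup>2" using x by auto
    have "1 + x\<^sup>2 \<le> 5 / 8 * (1 + x) ^ 3"
    proof -
      have "(1 + x) ^ 3 = 1 + 3 * x + 3 * x\<^sup>2 + x ^ 3"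
        by (simp add: power2_eq_square power3_eq_cube algebra_simps)
      with False \<open>0 \<le> x ^ 3\<close> \<open>0 \<le> x\<^sup>2\<close> show ?thesis by linarith
    qed
    then have "(1 + x\<^sup>2) / (1 + x) ^ 3 \<le> 5 / 8"
      using x by (simp add: field_simps)
    moreover have "1\<^sup>2 \<le> (1 + sqrt (1 - x) / 2)\<^sup>2"
      using x by (intro power_mono) auto
    ultimately show ?thesis by simp
  qed
  also have "\<dots> \<le> 2 / pi * (1 + sqrt (1 - x) / 2)\<^sup>2"
    using pi by (intro mult_right_mono) auto
  finally show ?thesis .
qed

section \<open>Expected zeros of a Gaussian sum with a constant term\<close>

text \<open>Measurability of the zero count is never established: the count is dominated pointwise
  by a liminf of measurable cell counts, and Fatou is applied to those.\<close>

lemma expected_card_zeros_le: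
  fixes \<phi> \<phi>' :: "'i \<Rightarrow> real \<Rightarrow> real"
  assumes T: "finite T" "m \<notin> T" and "0 < b"
    and deriv: "\<And>e x. e \<in> T \<Longrightarrow> (\<phi> e has_real_derivative \<phi>' e x) (at x)"
    and cont: "\<And>e. e \<in> T \<Longrightarrow> continuous_on UNIV (\<phi>' e)"
  shows "(\<integral>\<^sup>+a. of_nat (card {x \<in> {0<..<b}. a m + (\<Sum>e\<in>T. a e * \<phi> e x) = 0}) \<partial>PiM (insert m T) (\<lambda>_. std_normal))
    \<le> ennreal (1 / sqrt (2 * pi)) *
       (\<integral>\<^sup>+t. ennreal (sqrt (\<Sum>e\<in>T. (\<phi>' e t)\<^sup>2)) * indicator {0<..<b} t \<partial>lborel)" (is "_ \<le> ?R")
proof -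
  let ?P = "PiM (insert m T) (\<lambda>_. std_normal)" and ?Q = "PiM T (\<lambda>_. std_normal)"
  have [measurable]: "\<phi> e \<in> borel_measurable borel" "\<phi>' e \<in> borel_measurable borel" if "e \<in> T" for e
    using cont[OF that] deriv[OF that]
    by (auto intro!: borel_measurable_continuous_onI continuous_at_imp_continuous_on DERIV_isCont)
  define G where "G a x = (\<Sum>e\<in>T. a e * \<phi> e x)" for a x
  define G' where "G' a x = (\<Sum>e\<in>T. a e * \<phi>' e x)" for a x
  define L where "L p q a = (\<integral>\<^sup>+t. ennreal \<bar>G' a t\<bar> * indicator {p<..<q} t \<partial>lborel)" for p q a
  \<comment> \<open>The event that the endpoint bound permits a zero in the cell; the left side is
    the sum of the two endpoint values of \<open>a m + G a x\<close>.\<close>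
  define A where "A p q a \<longleftrightarrow> ennreal \<bar>2 * a m + (G a p + G a q)\<bar> \<le> L p q a" for p q a
  define p where "p n i = real i * b / real n" for n i :: nat
  \<comment> \<open>\<open>L\<close> is needed both on the full coefficient space, inside the event
    \<open>A\<close>, and on the space without the coordinate \<open>m\<close>.\<close>
  have L_meas: "L u v \<in> borel_measurable (PiM J (\<lambda>_. borel))" if "T \<subseteq> J" for J u v
  proof -
    have [measurable]: "(\<lambda>w. w e) \<in> borel_measurable (PiM J (\<lambda>_. borel))" if "e \<in> T" for e
      using measurable_component_singleton[of e J "\<lambda>_. borel"] that \<open>T \<subseteq> J\<close> by auto
    show ?thesis unfolding L_def G'_def by measurable
  qed
  note [measurable] = L_meas[OF order_refl] L_meas[OF subset_insertI]
  have [measurable]: "(\<lambda>a. G a x) \<in> borel_measurable (PiM (insert m T) (\<lambda>_. borel))" for x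
    unfolding G_def by measurable
  have [measurable]: "Measurable.pred (PiM (insert m T) (\<lambda>_. borel)) (A u v)" for u v
    unfolding A_def pred_def by (rule borel_measurable_le) measurable
  have count: "of_nat (card {x \<in> {0<..<b}. a m + G a x = 0})
      \<le> liminf (\<lambda>n. \<Sum>i<n. indicator {a. A (p n i) (p n (Suc i)) a} a :: ennreal)" for a
  \<comment> \<open>An infinite zero set has \<open>card\<close> equal to 0, so only the finite case
    has content.\<close>
  proof (cases "finite {x \<in> {0<..<b}. a m + G a x = 0}")
    case True
    have "\<forall>\<^sub>F n in sequentially. of_nat (card {x \<in> {0<..<b}. a m + G a x = 0})
       \<le> (\<Sum>i<n. indicator {a. A (p n i) (p n (Suc i)) a} a :: ennreal)"
      using eventually_card_le_card_cells[OF True Collect_subset]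
    proof eventually_elim
      case (elim n)
      have sub: "{i. i < n \<and> (\<exists>x\<in>{x \<in> {0<..<b}. a m + G a x = 0}. p n i \<le> x \<and> x \<le> p n (Suc i))}
          \<subseteq> {i. i < n \<and> A (p n i) (p n (Suc i)) a}"
      proof safe
        fix i x assume x: "a m + G a x = 0" "p n i \<le> x" "x \<le> p n (Suc i)"
        have "ennreal \<bar>(a m + G a (p n i)) + (a m + G a (p n (Suc i)))\<bar> \<le> L (p n i) (p n (Suc i)) a"
          unfolding L_def
        proof (rule abs_endpoint_sum_le_variation[where f = "\<lambda>x. a m + G a x" and y = x])
          show "((\<lambda>x. a m + G a x) has_real_derivative G' a x) (at x)" for x
            unfolding G_def G'_def by (auto intro!: derivative_eq_intros deriv simp: mult.commute)
          show "continuous_on UNIV (G' a)"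
            unfolding G'_def by (intro continuous_intros cont)
        qed (use x in auto)
        then show "A (p n i) (p n (Suc i)) a"
          unfolding A_def by (simp add: algebra_simps)
      qed
      have "card {x \<in> {0<..<b}. a m + G a x = 0} \<le> card {i. i < n \<and> A (p n i) (p n (Suc i)) a}"
        using elim card_mono[OF _ sub] unfolding p_def by (auto intro: order_trans)
      also have "\<dots> = (\<Sum>i<n. indicator {a. A (p n i) (p n (Suc i)) a} a)"
        by (simp add: indicator_def sum.If_cases Collect_conj_eq[symmetric] lessThan_def)
      finally have "(of_nat (card {x \<in> {0<..<b}. a m + G a x = 0}) :: ennreal)
         \<le> of_nat (\<Sum>i<n. indicator {a. A (p n i) (p n (Suc i)) a} a)"
        by (rule of_nat_mono)
      then show ?case by (simp add: indicator_def of_bool_def if_distrib[of of_nat] cong: if_cong)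
    qed
    then show ?thesis by (rule Liminf_bounded)
  qed simp
  have cell: "(\<integral>\<^sup>+a. indicator {a. A u v a} a \<partial>?P) \<le> ennreal (1 / sqrt (2 * pi)) * (\<integral>\<^sup>+a. L u v a \<partial>?Q)" for u v
  proof -
    \<comment> \<open>Changing the coordinate \<open>m\<close> leaves \<open>G\<close> and
      \<open>G'\<close> fixed, so the inner integral over that coordinate sees a fixed
      strip.\<close>
    have upd: "G (a(m := y)) x = G a x" "G' (a(m := y)) x = G' a x" for a y x
      unfolding G_def G'_def using T(2) by (auto intro!: sum.cong)
    have "(\<integral>\<^sup>+a. indicator {a. A u v a} a \<partial>?P)
        = (\<integral>\<^sup>+a. (\<integral>\<^sup>+y. indicator {a. A u v a} (a(m := y)) \<partial>std_normal) \<partial>?Q)"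
      using T by (intro std_normal_prod.product_nn_integral_insert) measurable
    also have "\<dots> = (\<integral>\<^sup>+a. (\<integral>\<^sup>+y. indicator {y. ennreal \<bar>2 * y + (G a u + G a v)\<bar> \<le> L u v a} y \<partial>std_normal) \<partial>?Q)"
      by (intro nn_integral_cong) (simp add: A_def L_def upd indicator_def)
    also have "\<dots> = (\<integral>\<^sup>+a. emeasure std_normal {y. ennreal \<bar>2 * y + (G a u + G a v)\<bar> \<le> L u v a} \<partial>?Q)"
      by (intro nn_integral_cong nn_integral_indicator) measurable
    also have "\<dots> \<le> (\<integral>\<^sup>+a. ennreal (1 / sqrt (2 * pi)) * L u v a \<partial>?Q)"
      by (intro nn_integral_mono emeasure_std_normal_strip_le)
    also have "\<dots> = ennreal (1 / sqrt (2 * pi)) * (\<integral>\<^sup>+a. L u v a \<partial>?Q)"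
      by (intro nn_integral_cmult) measurable
    finally show ?thesis .
  qed
  interpret Q: prob_space ?Q by (intro prob_space_PiM std_normal.prob_space_axioms)
  interpret QL: pair_sigma_finite ?Q lborel ..
  have [measurable]: "(\<lambda>(a, t). G' a t) \<in> borel_measurable (PiM T (\<lambda>_. borel) \<Otimes>\<^sub>M borel)"
    unfolding G'_def by measurable
  \<comment> \<open>The open cells are disjoint subsets of \<open>{0<..<b}\<close>, so their
    variations add up to at most the total one. This makes the final bound independent of
    \<open>n\<close>.\<close>
  have cells: "(\<Sum>i<n. L (p n i) (p n (Suc i)) a) \<le> L 0 b a" if [measurable]: "G' a \<in> borel_measurable borel" for n a
  proof -
    have "(\<Sum>i<n. L (p n i) (p n (Suc i)) a)
       = (\<integral>\<^sup>+t. (\<Sum>i<n. ennreal \<bar>G' a t\<bar> * indicator {p n i<..<p n (Suc i)} t) \<partial>lborel)"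
      unfolding L_def by (subst nn_integral_sum) auto
    also have "\<dots> \<le> L 0 b a"
      unfolding L_def sum_distrib_left[symmetric]
    proof (intro nn_integral_mono mult_left_mono)
      fix t
      have p_mono: "p n i \<le> p n j" if "i \<le> j" for i j
        using that \<open>0 < b\<close> by (simp add: p_def divide_right_mono)
      have "disjoint_family_on (\<lambda>i. {p n i<..<p n (Suc i)}) {..<n}"
      proof (unfold disjoint_family_on_def, safe)
        fix i j t assume "i \<noteq> j" "t \<in> {p n i<..<p n (Suc i)}" "t \<in> {p n j<..<p n (Suc j)}"
        then show "t \<in> {}"
          using p_mono[of "Suc i" j] p_mono[of "Suc j" i] by (cases "i < j") auto
      qed
      then have "(\<Sum>i<n. indicator {p n i<..<p n (Suc i)} t) = (indicator (\<Union>i<n. {p n i<..<p n (Suc i)}) t :: ennreal)"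
        by (intro indicator_UN_disjoint[symmetric]) auto
      also have "\<dots> \<le> indicator {0<..<b} t"
      proof -
        have "(\<Union>i<n. {p n i<..<p n (Suc i)}) \<subseteq> {0<..<b}"
        proof safe
          fix i t assume "i < n" "t \<in> {p n i<..<p n (Suc i)}"
          moreover have "p n n = b" "p n 0 = 0" using \<open>i < n\<close> by (auto simp: p_def)
          ultimately show "t \<in> {0<..<b}"
            using p_mono[of 0 i] p_mono[of "Suc i" n] by auto
        qed
        then show ?thesis by (rule indicator_leI[OF subsetD])
      qed
      finally show "(\<Sum>i<n. indicator {p n i<..<p n (Suc i)} t) \<le> (indicator {0<..<b} t :: ennreal)" .
    qed simp
    finally show ?thesis .
  qed
  have G'_cont: "G' a \<in> borel_measurable borel" for a
    unfolding G'_def by measurable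
  have step: "(\<integral>\<^sup>+a. (\<Sum>i<n. indicator {a. A (p n i) (p n (Suc i)) a} a) \<partial>?P) \<le> ?R" for n
  proof -
    have "(\<integral>\<^sup>+a. (\<Sum>i<n. indicator {a. A (p n i) (p n (Suc i)) a} a) \<partial>?P)
       = (\<Sum>i<n. \<integral>\<^sup>+a. indicator {a. A (p n i) (p n (Suc i)) a} a \<partial>?P)"
      by (intro nn_integral_sum) measurable
    also have "\<dots> \<le> (\<Sum>i<n. ennreal (1 / sqrt (2 * pi)) * (\<integral>\<^sup>+a. L (p n i) (p n (Suc i)) a \<partial>?Q))"
      by (intro sum_mono cell)
    also have "\<dots> = ennreal (1 / sqrt (2 * pi)) * (\<integral>\<^sup>+a. (\<Sum>i<n. L (p n i) (p n (Suc i)) a) \<partial>?Q)"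
      by (subst nn_integral_sum) (auto simp: sum_distrib_left)
    also have "\<dots> \<le> ennreal (1 / sqrt (2 * pi)) * (\<integral>\<^sup>+a. L 0 b a \<partial>?Q)"
      by (intro mult_left_mono nn_integral_mono cells G'_cont) auto
    \<comment> \<open>After exchanging the integrals, \<open>G' a t\<close> at fixed
      \<open>t\<close> is a Gaussian linear form with coefficients
      \<open>\<phi>' e t\<close>.\<close>
    also have "(\<integral>\<^sup>+a. L 0 b a \<partial>?Q) = (\<integral>\<^sup>+t. (\<integral>\<^sup>+a. ennreal \<bar>G' a t\<bar> * indicator {0<..<b} t \<partial>?Q) \<partial>lborel)"
      unfolding L_def by (intro QL.Fubini'[symmetric]) measurable
    also have "\<dots> = (\<integral>\<^sup>+t. (\<integral>\<^sup>+a. ennreal \<bar>G' a t\<bar> \<partial>?Q) * indicator {0<..<b} t \<partial>lborel)"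
      by (intro nn_integral_cong nn_integral_multc) measurable
    also have "\<dots> \<le> (\<integral>\<^sup>+t. ennreal (sqrt (\<Sum>e\<in>T. (\<phi>' e t)\<^sup>2)) * indicator {0<..<b} t \<partial>lborel)"
      unfolding G'_def by (intro nn_integral_mono mult_right_mono nn_integral_abs_linear_form_le T) auto
    finally show ?thesis by (simp add: mult_left_mono)
  qed
  have "(\<integral>\<^sup>+a. of_nat (card {x \<in> {0<..<b}. a m + G a x = 0}) \<partial>?P)
     \<le> (\<integral>\<^sup>+a. liminf (\<lambda>n. \<Sum>i<n. indicator {a. A (p n i) (p n (Suc i)) a} a) \<partial>?P)"
    by (intro nn_integral_mono count)
  also have "\<dots> \<le> liminf (\<lambda>n. \<integral>\<^sup>+a. (\<Sum>i<n. indicator {a. A (p n i) (p n (Suc i)) a} a) \<partial>?P)"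
    by (intro nn_integral_liminf borel_measurable_sum) measurable
  also have "\<dots> \<le> liminf (\<lambda>n. ?R)"
    by (intro Liminf_mono always_eventually allI step)
  finally show ?thesis by (simp add: G_def Liminf_const)
qed

section \<open>Integrating the majorant\<close>

lemma nn_integral_majorant:
  fixes \<epsilon> :: real
  assumes "0 < \<epsilon>" "\<epsilon> < 1"
  shows "(\<integral>\<^sup>+t. ennreal (1 / ((1 - t) * sqrt (1 - t)) + 1 / (2 * (1 - t))) * indicator {0..1 - \<epsilon>} t \<partial>lborel)
    = ennreal (2 / sqrt \<epsilon> - ln \<epsilon> / 2 - 2)"
proof -
  \<comment> \<open>An explicit antiderivative of the integrand; \<open>F 0 = 2\<close> accounts for
    the constant \<open>- 2\<close>.\<close>
  define F where "F t = 2 / sqrt (1 - t) - ln (1 - t) / 2" for t :: real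
  have "(\<integral>\<^sup>+t. ennreal (1 / ((1 - t) * sqrt (1 - t)) + 1 / (2 * (1 - t))) * indicator {0..1 - \<epsilon>} t \<partial>lborel)
      = ennreal (F (1 - \<epsilon>) - F 0)"
  proof (rule nn_integral_FTC_Icc)
    fix t assume t: "t \<in> {0..1 - \<epsilon>}"
    then have "t < 1" using assms by auto
    then show "0 \<le> 1 / ((1 - t) * sqrt (1 - t)) + 1 / (2 * (1 - t))" by simp
    show "(F has_real_derivative 1 / ((1 - t) * sqrt (1 - t)) + 1 / (2 * (1 - t))) (at t)"
    proof -
      have d1: "((\<lambda>t. 2 / sqrt (1 - t)) has_real_derivative 1 / ((1 - t) * sqrt (1 - t))) (at t)"
        using \<open>t < 1\<close> by (auto intro!: derivative_eq_intros simp: field_simps)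
      have d2: "((\<lambda>t. ln (1 - t) / 2) has_real_derivative - (1 / (2 * (1 - t)))) (at t)"
        using \<open>t < 1\<close> by (auto intro!: derivative_eq_intros simp: field_simps)
      show ?thesis
        using DERIV_diff[OF d1 d2] by (simp add: F_def[abs_def])
    qed
  qed (use assms in auto)
  then show ?thesis using assms by (simp add: F_def)
qed

section \<open>The bound for random polynomials\<close>

theorem theorem1p4:
  fixes \<epsilon> :: real and S :: "nat set"
  assumes "0 < \<epsilon>" "\<epsilon> < 1" "finite S" "S \<noteq> {}"
  shows "expected_zeros S {0<..<1 - \<epsilon>}
    \<le> ennreal ((1 / (2 * pi)) * (ln (2 / \<epsilon>) + 4 / sqrt \<epsilon> - 4))"
proof -
  define m where "m = Min S"
  define T where "T = S - {m}"
  have m: "m \<in> S" "\<And>e. e \<in> S \<Longrightarrow> m \<le> e" using assms by (auto simp: m_def)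
  then have S: "S = insert m T" "finite T" "m \<notin> T" using assms by (auto simp: T_def)
  \<comment> \<open>\<open>B t / pi\<close> is the derivative of the claimed bound with respect to \<open>t = 1 - \<epsilon>\<close>.\<close>
  define B where "B t = 1 / ((1 - t) * sqrt (1 - t)) + 1 / (2 * (1 - t))" for t :: real
  define \<phi> where "\<phi> e x = x ^ (e - m)" for e and x :: real
  define \<phi>' where "\<phi>' e x = real (e - m) * x ^ (e - m - 1)" for e and x :: real
  \<comment> \<open>On the interval \<open>x\<close> is positive, so the factor \<open>x ^ m\<close>
    that is divided out never vanishes.\<close>
  have zeros: "num_zeros S {0<..<1 - \<epsilon>} a = card {x \<in> {0<..<1 - \<epsilon>}. a m + (\<Sum>e\<in>T. a e * \<phi> e x) = 0}" for a
  proof -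
    have "rand_poly S a x = x ^ m * (a m + (\<Sum>e\<in>T. a e * \<phi> e x))" for x
    proof -
      have "(\<Sum>e\<in>T. a e * x ^ e) = x ^ m * (\<Sum>e\<in>T. a e * \<phi> e x)"
        unfolding sum_distrib_left
      proof (intro sum.cong refl)
        fix e assume "e \<in> T"
        then have "x ^ e = x ^ m * x ^ (e - m)" using m by (simp add: S power_add[symmetric])
        then show "a e * x ^ e = x ^ m * (a e * \<phi> e x)" by (simp add: \<phi>_def)
      qed
      then show ?thesis
        using S by (simp add: rand_poly_def algebra_simps)
    qed
    then show ?thesis
      unfolding num_zeros_def by (intro arg_cong[where f = card]) auto
  qed
  \<comment> \<open>The factor \<open>sqrt (2 / pi)\<close> multiplies with the density bound
    \<open>1 / sqrt (2 * pi)\<close> to give \<open>1 / pi\<close>.\<close>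
  have bound: "sqrt (\<Sum>e\<in>T. (\<phi>' e t)\<^sup>2) \<le> sqrt (2 / pi) * B t" if t: "0 < t" "t < 1 - \<epsilon>" for t
  proof -
    have t1: "0 \<le> t" "t < 1" using t assms by auto
    then have u: "0 \<le> t\<^sup>2" "t\<^sup>2 < 1" by (auto simp: power_less_one_iff)
    \<comment> \<open>Distinct exponents have distinct differences, so the sum runs over a set of
      naturals and is bounded by the full series, whatever \<open>S\<close> is.\<close>
    have "inj_on (\<lambda>e. e - m) T"
      using m by (intro inj_onI) (metis S(1) insertCI le_add_diff_inverse)
    then have "(\<Sum>e\<in>T. (\<phi>' e t)\<^sup>2) = (\<Sum>n\<in>(\<lambda>e. e - m) ` T. (real n)\<^sup>2 * (t\<^sup>2) ^ (n - 1))"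
      by (simp add: sum.reindex \<phi>'_def power_mult_distrib power_mult[symmetric] mult.commute)
    also have "\<dots> \<le> (1 + t\<^sup>2) / (1 - t\<^sup>2) ^ 3"
      using S u by (intro sum_square_power_le) auto
    also have "\<dots> = (1 + t\<^sup>2) / (1 + t) ^ 3 / (1 - t) ^ 3"
      by (simp add: power2_eq_square square_diff_one_factored[symmetric] power_mult_distrib[symmetric] algebra_simps)
    also have "\<dots> \<le> 2 / pi * (1 + sqrt (1 - t) / 2)\<^sup>2 / (1 - t) ^ 3"
      using t1 by (intro divide_right_mono density_ratio_le) auto
    also have "\<dots> = 2 / pi * (B t)\<^sup>2"
    proof -
      \<comment> \<open>In terms of \<open>r\<close> one has
        \<open>B t = (1 + r / 2) / r ^ 3\<close>, which explains the factor
        \<open>(1 + sqrt (1 - t) / 2)^2\<close> in the comparison.\<close>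
      define r where "r = sqrt (1 - t)"
      have r: "1 - t = r\<^sup>2" "r > 0" using t1 by (auto simp: r_def)
      have "B t = (1 + r / 2) / r ^ 3"
        using r(2) by (simp add: B_def r(1) field_simps power2_eq_square power3_eq_cube)
      moreover have "(r\<^sup>2) ^ 3 = (r ^ 3)\<^sup>2" by (simp add: power_mult[symmetric])
      ultimately show ?thesis unfolding r_def[symmetric] r(1) using r(2)
        by (simp add: power_divide)
    qed
    finally have "sqrt (\<Sum>e\<in>T. (\<phi>' e t)\<^sup>2) \<le> sqrt (2 / pi * (B t)\<^sup>2)"
      by (rule real_sqrt_le_mono)
    also have "\<dots> = sqrt (2 / pi) * B t"
    proof -
      have "0 \<le> B t" using t1 by (simp add: B_def)
      then show ?thesis by (simp only: real_sqrt_mult) simp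
    qed
    finally show ?thesis .
  qed
  have "expected_zeros S {0<..<1 - \<epsilon>}
     = (\<integral>\<^sup>+a. of_nat (card {x \<in> {0<..<1 - \<epsilon>}. a m + (\<Sum>e\<in>T. a e * \<phi> e x) = 0}) \<partial>PiM (insert m T) (\<lambda>_. std_normal))"
    unfolding expected_zeros_def coeff_space_def zeros unfolding S(1) by (simp add: ennreal_of_nat_eq_real_of_nat)
  also have "\<dots> \<le> ennreal (1 / sqrt (2 * pi)) *
       (\<integral>\<^sup>+t. ennreal (sqrt (\<Sum>e\<in>T. (\<phi>' e t)\<^sup>2)) * indicator {0<..<1 - \<epsilon>} t \<partial>lborel)"
    using assms S unfolding \<phi>_def \<phi>'_def
    by (intro expected_card_zeros_le) (auto intro!: derivative_eq_intros continuous_intros)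
  also have "\<dots> \<le> ennreal (1 / sqrt (2 * pi)) *
       (\<integral>\<^sup>+t. ennreal (sqrt (2 / pi)) * (ennreal (B t) * indicator {0..1 - \<epsilon>} t) \<partial>lborel)"
  proof (intro mult_left_mono nn_integral_mono)
    fix t
    show "ennreal (sqrt (\<Sum>e\<in>T. (\<phi>' e t)\<^sup>2)) * indicator {0<..<1 - \<epsilon>} t
        \<le> ennreal (sqrt (2 / pi)) * (ennreal (B t) * indicator {0..1 - \<epsilon>} t)"
      using bound[of t] by (auto simp: indicator_def ennreal_mult'[symmetric] intro!: ennreal_leI)
  qed simp
  also have "\<dots> = ennreal (1 / sqrt (2 * pi)) * (ennreal (sqrt (2 / pi)) * ennreal (2 / sqrt \<epsilon> - ln \<epsilon> / 2 - 2))"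
    unfolding nn_integral_majorant[OF assms(1,2), symmetric] B_def
    by (subst nn_integral_cmult) auto
  also have "\<dots> = ennreal (1 / pi * (2 / sqrt \<epsilon> - ln \<epsilon> / 2 - 2))"
  proof -
    have "1 / sqrt (2 * pi) * sqrt (2 / pi) = 1 / pi"
      by (simp add: real_sqrt_mult real_sqrt_divide)
    then show ?thesis
      by (simp add: ennreal_mult'[symmetric] mult.assoc[symmetric])
  qed
  also have "\<dots> \<le> ennreal ((1 / (2 * pi)) * (ln (2 / \<epsilon>) + 4 / sqrt \<epsilon> - 4))"
  proof (rule ennreal_leI)
    \<comment> \<open>The integral yields \<open>ln (1 / \<epsilon>)\<close> in place of
      \<open>ln (2 / \<epsilon>)\<close>, so the claim holds with exactly
      \<open>ln 2 / (2 * pi)\<close> to spare.\<close>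
    have "(1 / (2 * pi)) * (ln (2 / \<epsilon>) + 4 / sqrt \<epsilon> - 4) - 1 / pi * (2 / sqrt \<epsilon> - ln \<epsilon> / 2 - 2) = ln 2 / (2 * pi)"
      using assms by (simp add: ln_div field_simps)
    moreover have "0 \<le> ln 2 / (2 * pi)" by simp
    ultimately show "1 / pi * (2 / sqrt \<epsilon> - ln \<epsilon> / 2 - 2) \<le> (1 / (2 * pi)) * (ln (2 / \<epsilon>) + 4 / sqrt \<epsilon> - 4)"
      by linarith
  qed
  finally show ?thesis .
qed

end
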